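(* Let $n\ge 0$ be an integer, let $\nu>-\tfrac12$ be real with $\nu\ne 0$, let $\lambda$ be a nonzero complex number, let $C_n^{(\nu)}$ be the Gegenbauer polynomial, and put $\widehat{C_n^{(\nu)}}(\lambda)=\int_{-1}^{1}C_n^{(\nu)}(x)e^{i\lambda x}\,dx$. Then $$\widehat{C_n^{(\nu)}}(\lambda)=2(2\nu)_n e^{i\lambda}\sum_{k=0}^{n}2^{2k}\frac{(n+2\nu)_k(\nu)_k}{(n-k)!\,(2\nu)_{2k}}\left[\frac{e^{-2i\lambda}E_k(2i\lambda)-1}{(-2i\lambda)^{k+1}}\right],$$ $$\widehat{C_n^{(\nu)}}(\lambda)=\frac{2(2\nu)_n(\nu)_n}{(2\nu)_{2n}}\sum_{k=0}^{n}2^{2k}\frac{(n+2\nu)_k(2\nu+2k)_{2n-2k}}{(n-k)!\,(\nu+k)_{n-k}}\left[\frac{(-1)^{n-k}e^{-i\lambda}-e^{i\lambda}}{(-2i\lambda)^{k+1}}\right],$$ and also $$\widehat{C_n^{(\nu)}}(\lambda)=\frac{(2\nu)_n}{i\lambda\,n!}\left[(-1)^{n+1}e^{-i\lambda}\,{}_3F_1\!\left(n+2\nu,-n,1;\,\nu+\tfrac12;\,-\frac{1}{2i\lambda}\right)+e^{i\lambda}\,{}_3F_1\!\left(n+2\nu,-n,1;\,\nu+\tfrac12;\,\frac{1}{2i\lambda}\right)\right].$$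
   Context: The Gegenbauer polynomials are $C_n^{(\nu)}(x)=\frac{(2\nu)_n}{(\nu+1/2)_n}P_n^{(\nu-1/2,\nu-1/2)}(x)$, where $P_n^{(\alpha,\beta)}(x)=\frac{1}{2^n}\sum_{k=0}^{n}\binom{\alpha+n}{k}\binom{\beta+n}{n-k}(x-1)^{n-k}(x+1)^k$ is the Jacobi polynomial and $\binom{r}{m}=\frac{r(r-1)\cdots(r-m+1)}{m!}$. The shifted factorial is $(a)_0=1$, $(a)_m=a(a+1)\cdots(a+m-1)$. $E_k(x)=\sum_{j=0}^{k}\frac{x^j}{j!}$. The hypergeometric expression is the terminating sum ${}_3F_1(a,-n,c;\,d;\,z)=\sum_{k=0}^{n}\frac{(a)_k(-n)_k(c)_k}{(d)_k\,k!}z^k$. *)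

theory Defs
  imports "HOL-Analysis.Analysis"
begin

text \<open>The shifted factorial \<open>(a)\<^sub>m\<close> is \<^const>\<open>pochhammer\<close>, and the binomial coefficient with
  non-integral upper argument is \<^const>\<open>gbinomial\<close>.\<close>

definition jacobi :: "'a::field_char_0 \<Rightarrow> 'a \<Rightarrow> nat \<Rightarrow> 'a \<Rightarrow> 'a" where
  "jacobi \<alpha> \<beta> n x =
     1 / 2 ^ n * (\<Sum>k=0..n. ((\<alpha> + of_nat n) gchoose k) * ((\<beta> + of_nat n) gchoose (n - k))
                              * (x - 1) ^ (n - k) * (x + 1) ^ k)"

definition gegenbauer :: "'a::field_char_0 \<Rightarrow> nat \<Rightarrow> 'a \<Rightarrow> 'a" where
  "gegenbauer \<nu> n x =
     pochhammer (2 * \<nu>) n / pochhammer (\<nu> + 1 / 2) n * jacobi (\<nu> - 1 / 2) (\<nu> - 1 / 2) n x"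

definition gegenbauer_hat :: "real \<Rightarrow> nat \<Rightarrow> complex \<Rightarrow> complex" where
  "gegenbauer_hat \<nu> n w =
     integral {-1..1} (\<lambda>x::real. complex_of_real (gegenbauer \<nu> n x) * exp (\<i> * w * complex_of_real x))"

definition exp_partial :: "nat \<Rightarrow> 'a::field_char_0 \<Rightarrow> 'a" where
  "exp_partial k x = (\<Sum>j=0..k. x ^ j / fact j)"

text \<open>The terminating sum \<open>\<^sub>3F\<^sub>1(a, -n, c; d; z)\<close>; the second argument is \<open>n\<close> itself, and the
  upper parameter \<open>-n\<close> is inserted by the definition.\<close>

definition hyp3F1 :: "'a::field_char_0 \<Rightarrow> nat \<Rightarrow> 'a \<Rightarrow> 'a \<Rightarrow> 'a \<Rightarrow> 'a" where
  "hyp3F1 a n c d z =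
     (\<Sum>k=0..n. pochhammer a k * pochhammer (- of_nat n) k * pochhammer c k
                 / (pochhammer d k * fact k) * z ^ k)"

end

(* With x = 1 - 2t, Vandermonde's identity turns the Gegenbauer polynomial into a polynomial in t
  with hypergeometric coefficients. Integrating t^k exp(i w x) termwise gives the first formula.
  The reflection x -> -x yields a linear relation between these coefficients, which collapses the
  double sum created by the partial exponential sums and gives the second formula; the third is the
  second one written in hypergeometric notation. *)

theory Submission
  imports Defs
begin

section \<open>Jacobi polynomials: reflection and expansion in powers of t, where x = 1 - 2t\<close>

lemma jacobi_minus:
  fixes \<alpha> \<beta> x :: "'a::field_char_0"
  shows "jacobi \<alpha> \<beta> n (- x) = (-1) ^ n * jacobi \<beta> \<alpha> n x"
proof -
  \<comment> \<open>Term n - k of the sum for (\<alpha>, \<beta>) at -x matches term k of the sum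
    for (\<beta>, \<alpha>) at x up to the common sign (-1)^n. Reversing the order of summation then
    gives the claim.\<close>
  have reflect: "((\<alpha> + of_nat n) gchoose (n - k)) * ((\<beta> + of_nat n) gchoose (n - (n - k)))
          * (- x - 1) ^ (n - (n - k)) * (- x + 1) ^ (n - k)
      = (-1) ^ n * (((\<beta> + of_nat n) gchoose k) * ((\<alpha> + of_nat n) gchoose (n - k))
          * (x - 1) ^ (n - k) * (x + 1) ^ k)" if "k \<le> n" for k
  proof -
    have "(- x - 1) ^ k = (-1) ^ k * (x + 1) ^ k" "(- x + 1) ^ (n - k) = (-1) ^ (n - k) * (x - 1) ^ (n - k)"
      by (simp_all flip: power_mult_distrib)
    moreover have "(-1::'a) ^ n = (-1) ^ k * (-1) ^ (n - k)"
      using that by (simp flip: power_add)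
    ultimately show ?thesis
      using that by (simp add: mult_ac)
  qed
  have "(\<Sum>k=0..n. ((\<alpha> + of_nat n) gchoose k) * ((\<beta> + of_nat n) gchoose (n - k)) * (- x - 1) ^ (n - k) * (- x + 1) ^ k)
      = (-1) ^ n * (\<Sum>k=0..n. ((\<beta> + of_nat n) gchoose k) * ((\<alpha> + of_nat n) gchoose (n - k)) * (x - 1) ^ (n - k) * (x + 1) ^ k)"
    by (subst sum.atLeastAtMost_rev, unfold sum_distrib_left, rule sum.cong)
      (simp_all only: add_0_right atLeastAtMost_iff reflect)
  then show ?thesis
    by (simp add: jacobi_def)
qed

text \<open>For x = 1 - 2t the product of powers in the definition is 2^n (-t)^(n-k) (1-t)^k.
  Expanding (1-t)^k and exchanging the sums leaves, for each m, a convolution of binomial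
  coefficients that Vandermonde's identity evaluates.\<close>

lemma jacobi_eq_sum:
  fixes \<alpha> \<beta> t :: "'a::field_char_0"
  shows "jacobi \<alpha> \<beta> n (1 - 2 * t) =
    (\<Sum>m\<le>n. ((\<alpha> + of_nat n) gchoose (n - m)) * ((\<alpha> + \<beta> + of_nat (n + m)) gchoose m) * (- t) ^ m)"
proof -
  let ?A = "\<alpha> + of_nat n" and ?B = "\<beta> + of_nat n"
  have expand: "(1 - 2 * t - 1) ^ (n - k) * (1 - 2 * t + 1) ^ k
      = 2 ^ n * (\<Sum>m=n-k..n. of_nat (k choose (n - m)) * (- t) ^ m)" if "k \<le> n" for k
  proof -
    have "(1 - t) ^ k = (\<Sum>j\<le>k. of_nat (k choose j) * (- t) ^ (k - j))"
      using binomial_ring[of 1 "- t" k] by simp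
    then have "(- t) ^ (n - k) * (1 - t) ^ k = (\<Sum>j\<le>k. of_nat (k choose j) * (- t) ^ (n - j))"
      using that by (auto simp: sum_distrib_left mult.left_commute simp flip: power_add intro!: sum.cong)
    also have "\<dots> = (\<Sum>m=n-k..n. of_nat (k choose (n - m)) * (- t) ^ m)"
      using that by (intro sum.reindex_bij_witness[of _ "\<lambda>m. n - m" "\<lambda>j. n - j"]) auto
    finally have "(- t) ^ (n - k) * (1 - t) ^ k = \<dots>" .
    moreover have "(1 - 2 * t - 1) ^ (n - k) = 2 ^ (n - k) * (- t) ^ (n - k)"
      "(1 - 2 * t + 1) ^ k = 2 ^ k * (1 - t) ^ k"
      by (simp_all add: algebra_simps flip: power_mult_distrib)
    moreover have "(2::'a) ^ n = 2 ^ (n - k) * 2 ^ k"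
      using that by (simp flip: power_add)
    ultimately show ?thesis
      by (simp add: mult_ac)
  qed
  \<comment> \<open>Trinomial revision pulls out \<open>?A gchoose (n - m)\<close>, which is
    independent of k. In the Vandermonde sum that remains, the upper arguments add up to ?A - (n -
    m) + ?B = \<alpha> + \<beta> + n + m.\<close>
  have coeff: "(\<Sum>k=n-m..n. (?A gchoose k) * (?B gchoose (n - k)) * of_nat (k choose (n - m)))
      = (?A gchoose (n - m)) * ((\<alpha> + \<beta> + of_nat (n + m)) gchoose m)" if "m \<le> n" for m
  proof -
    have "(\<Sum>k=n-m..n. (?A gchoose k) * (?B gchoose (n - k)) * of_nat (k choose (n - m)))
        = (\<Sum>k=n-m..n. (?A gchoose (n - m)) *
            (((?A - of_nat (n - m)) gchoose (k - (n - m))) * (?B gchoose (n - k))))"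
    proof (rule sum.cong)
      fix k assume "k \<in> {n-m..n}"
      then show "(?A gchoose k) * (?B gchoose (n - k)) * of_nat (k choose (n - m))
        = (?A gchoose (n - m)) * (((?A - of_nat (n - m)) gchoose (k - (n - m))) * (?B gchoose (n - k)))"
        using gbinomial_trinomial_revision[of "n - m" k ?A]
        by (simp add: binomial_gbinomial mult_ac)
    qed simp
    also have "\<dots> = (?A gchoose (n - m)) *
        (\<Sum>j\<le>m. ((?A - of_nat (n - m)) gchoose j) * (?B gchoose (m - j)))"
      unfolding sum_distrib_left using that
      by (intro sum.reindex_bij_witness[of _ "\<lambda>j. j + (n - m)" "\<lambda>k. k - (n - m)"]) auto
    also have "(\<Sum>j\<le>m. ((?A - of_nat (n - m)) gchoose j) * (?B gchoose (m - j)))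
        = (?A - of_nat (n - m) + ?B) gchoose m"
      by (rule gbinomial_Vandermonde[unfolded atLeast0AtMost])
    finally show ?thesis
      using that by (simp add: of_nat_diff algebra_simps)
  qed
  have "jacobi \<alpha> \<beta> n (1 - 2 * t) = (\<Sum>k=0..n. (?A gchoose k) * (?B gchoose (n - k))
      * (\<Sum>m=n-k..n. of_nat (k choose (n - m)) * (- t) ^ m))"
    unfolding jacobi_def sum_distrib_left[of "1 / 2 ^ n"]
  proof (rule sum.cong)
    fix k assume "k \<in> {0..n}"
    then show "1 / 2 ^ n * ((?A gchoose k) * (?B gchoose (n - k)) * (1 - 2 * t - 1) ^ (n - k) * (1 - 2 * t + 1) ^ k)
      = (?A gchoose k) * (?B gchoose (n - k)) * (\<Sum>m=n-k..n. of_nat (k choose (n - m)) * (- t) ^ m)"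
      using expand[of k] by (simp del: diff_0 add: mult.assoc)
  qed simp
  \<comment> \<open>The range m \<ge> n - k is written as n \<le> k + m, which is symmetric in k and
    m, so that the order of summation can be exchanged.\<close>
  also have "\<dots> = (\<Sum>k\<in>{0..n}. \<Sum>m\<in>{m\<in>{0..n}. n \<le> k + m}.
      (?A gchoose k) * (?B gchoose (n - k)) * of_nat (k choose (n - m)) * (- t) ^ m)"
    unfolding sum_distrib_left by (intro sum.cong) (auto simp: mult_ac)
  also have "\<dots> = (\<Sum>m\<in>{0..n}. \<Sum>k\<in>{k\<in>{0..n}. n \<le> k + m}.
      (?A gchoose k) * (?B gchoose (n - k)) * of_nat (k choose (n - m)) * (- t) ^ m)"
    by (rule sum.swap_restrict) auto
  also have "\<dots> = (\<Sum>m\<le>n. (\<Sum>k=n-m..n. (?A gchoose k) * (?B gchoose (n - k)) * of_nat (k choose (n - m))) * (- t) ^ m)"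
    unfolding sum_distrib_right by (intro sum.cong) auto
  finally show ?thesis
    by (simp add: coeff)
qed

section \<open>Gegenbauer coefficients and their reflection identity\<close>

text \<open>This is the coefficient of t^k stripped of (-1)^k / k!: integrating t^k exp(iwx)
  produces exactly the factor (-1)^k k!, so the stripped value is what appears in the
  transform.\<close>

definition gegenbauer_coeff :: "'a::field_char_0 \<Rightarrow> nat \<Rightarrow> nat \<Rightarrow> 'a" where
  "gegenbauer_coeff \<nu> n k =
     pochhammer (2 * \<nu>) n * (pochhammer (of_nat n + 2 * \<nu>) k / (fact (n - k) * pochhammer (\<nu> + 1 / 2) k))"

text \<open>Split \<open>pochhammer (\<nu> + 1 / 2) n\<close> at k: its tail cancels against the
  numerator of the first binomial coefficient in \<open>jacobi_eq_sum\<close>, and its head stays in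
  the denominator of the coefficient.\<close>

lemma gegenbauer_eq_sum:
  fixes \<nu> t :: "'a::field_char_0"
  assumes "pochhammer (\<nu> + 1 / 2) n \<noteq> 0"
  shows "gegenbauer \<nu> n (1 - 2 * t) = (\<Sum>k\<le>n. (-1) ^ k * gegenbauer_coeff \<nu> n k / fact k * t ^ k)"
proof -
  have "pochhammer (2 * \<nu>) n / pochhammer (\<nu> + 1 / 2) n *
      (((\<nu> - 1 / 2 + of_nat n) gchoose (n - k)) * ((\<nu> - 1 / 2 + (\<nu> - 1 / 2) + of_nat (n + k)) gchoose k) * (- t) ^ k)
    = (-1) ^ k * gegenbauer_coeff \<nu> n k / fact k * t ^ k" if "k \<le> n" for k
  proof -
    have split: "pochhammer (\<nu> + 1 / 2) n = pochhammer (\<nu> + 1 / 2) k * pochhammer (\<nu> + 1 / 2 + of_nat k) (n - k)"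
      using that by (rule pochhammer_product)
    have g1: "(\<nu> - 1 / 2 + of_nat n) gchoose (n - k) = pochhammer (\<nu> + 1 / 2 + of_nat k) (n - k) / fact (n - k)"
      using that by (simp add: gbinomial_pochhammer' of_nat_diff algebra_simps)
    have g2: "(\<nu> - 1 / 2 + (\<nu> - 1 / 2) + of_nat (n + k)) gchoose k = pochhammer (of_nat n + 2 * \<nu>) k / fact k"
      by (simp add: gbinomial_pochhammer' algebra_simps)
    have "pochhammer (\<nu> + 1 / 2 + of_nat k) (n - k) \<noteq> 0"
      using assms unfolding split by simp
    then show ?thesis
      unfolding g1 g2 split gegenbauer_coeff_def power_minus[of t] by (simp add: mult_ac)
  qed
  then show ?thesis
    unfolding gegenbauer_def jacobi_eq_sum sum_distrib_left by simp
qed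

text \<open>In the variable t = (1 - x) / 2 the reflection x -> -x is t -> 1 - t. The identity
  compares the coefficients of t^m on both sides of the parity relation, after expanding
  (1-t)^k.\<close>

lemma sum_gegenbauer_coeff_choose:
  fixes \<nu> :: "'a::{field_char_0, real_normed_field}"
  assumes "pochhammer (\<nu> + 1 / 2) n \<noteq> 0" and "m \<le> n"
  shows "(\<Sum>k=m..n. (-1) ^ k * gegenbauer_coeff \<nu> n k / fact k * of_nat (k choose m))
    = (-1) ^ n * gegenbauer_coeff \<nu> n m / fact m"
proof -
  define c where "c k = (-1) ^ k * gegenbauer_coeff \<nu> n k / fact k" for k
  have "(\<Sum>m\<le>n. (-1) ^ n * c m * t ^ m) = (\<Sum>m\<le>n. (-1) ^ m * (\<Sum>k=m..n. c k * of_nat (k choose m)) * t ^ m)" for t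
  proof -
    have "(\<Sum>m\<le>n. (-1) ^ n * c m * t ^ m) = (-1) ^ n * gegenbauer \<nu> n (1 - 2 * t)"
      unfolding gegenbauer_eq_sum[OF assms(1)] sum_distrib_left c_def by (simp only: mult.assoc)
    also have "\<dots> = gegenbauer \<nu> n (1 - 2 * (1 - t))"
      using jacobi_minus[of "\<nu> - 1 / 2" "\<nu> - 1 / 2" n "1 - 2 * t"]
      by (simp add: gegenbauer_def algebra_simps)
    also have "\<dots> = (\<Sum>k\<le>n. c k * (1 - t) ^ k)"
      using assms(1) unfolding c_def by (rule gegenbauer_eq_sum)
    also have "\<dots> = (\<Sum>k\<in>{..n}. \<Sum>m\<in>{m\<in>{..n}. m \<le> k}. c k * of_nat (k choose m) * (- t) ^ m)"
    proof (rule sum.cong)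
      fix k assume "k \<in> {..n}"
      then have "{m\<in>{..n}. m \<le> k} = {..k}"
        by auto
      then show "c k * (1 - t) ^ k = (\<Sum>m\<in>{m\<in>{..n}. m \<le> k}. c k * of_nat (k choose m) * (- t) ^ m)"
        using binomial_ring[of "- t" 1 k] by (simp add: sum_distrib_left mult_ac)
    qed simp
    also have "\<dots> = (\<Sum>m\<in>{..n}. \<Sum>k\<in>{k\<in>{..n}. m \<le> k}. c k * of_nat (k choose m) * (- t) ^ m)"
      by (rule sum.swap_restrict) auto
    also have "\<dots> = (\<Sum>m\<le>n. (-1) ^ m * (\<Sum>k=m..n. c k * of_nat (k choose m)) * t ^ m)"
      unfolding sum_distrib_left sum_distrib_right power_minus[of t]
      by (intro sum.cong) (auto simp: mult_ac)
    finally show ?thesis .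
  qed
  then have "\<forall>m\<le>n. (-1) ^ n * c m = (-1) ^ m * (\<Sum>k=m..n. c k * of_nat (k choose m))"
    by (intro polyfun_eq_coeffs[THEN iffD1] allI)
  then have "(-1) ^ n * c m = (-1) ^ m * (\<Sum>k=m..n. c k * of_nat (k choose m))"
    using assms(2) by blast
  then have "(\<Sum>k=m..n. c k * of_nat (k choose m)) = (-1) ^ m * ((-1) ^ n * c m)"
    by (simp only: minus_one_mult_self mult_1_left flip: mult.assoc)
  also have "\<dots> = (-1) ^ n * gegenbauer_coeff \<nu> n m / fact m"
    unfolding c_def by simp
  finally show ?thesis
    unfolding c_def .
qed

section \<open>Partial exponential sums and integrals of powers against an exponential\<close>

lemma exp_partial_Suc: "exp_partial (Suc k) z = exp_partial k z + z ^ Suc k / fact (Suc k)"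
  by (simp add: exp_partial_def)

text \<open>The derivative of E_k is E_(k-1). Writing it as E_k minus its top term covers k = 0 as
  well and keeps E_k visible for the cancellation in the next lemma.\<close>

lemma has_field_derivative_exp_partial:
  fixes z :: "'a::real_normed_field"
  shows "(exp_partial k has_field_derivative exp_partial k z - z ^ k / fact k) (at z)"
proof (induction k)
  case 0
  then show ?case
    by (simp add: exp_partial_def[abs_def])
next
  case (Suc k)
  have "((\<lambda>z::'a. z ^ Suc k / fact (Suc k)) has_field_derivative z ^ k / fact k) (at z)"
    by (rule DERIV_cdivide[OF DERIV_power[OF DERIV_ident], THEN DERIV_cong])
      (simp add: fact_Suc del: of_nat_Suc)
  from DERIV_add[OF Suc.IH this]
  have "((\<lambda>z. exp_partial k z + z ^ Suc k / fact (Suc k)) has_field_derivative exp_partial k z) (at z)"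
    by (simp del: power_Suc fact_Suc)
  moreover have "exp_partial (Suc k) z - z ^ Suc k / fact (Suc k) = exp_partial k z"
    by (simp add: exp_partial_Suc del: power_Suc fact_Suc)
  ultimately show ?case
    by (simp only: exp_partial_Suc[abs_def] add_diff_cancel_right')
qed

text \<open>Put a = 2iw and t = (1 - x) / 2. In the derivative of exp(iwx) E_k(at) the two terms
  with E_k cancel, because the inner derivative of at is -iw; only iw (at)^k / k! times the
  exponential survives. Hence a multiple of this product is an antiderivative, with t = 0 at x = 1
  and t = 1 at x = -1.\<close>

lemma has_integral_power_exp:
  fixes w :: complex
  assumes "w \<noteq> 0"
  shows "((\<lambda>x. of_real (((1 - x) / 2) ^ k) * exp (\<i> * w * of_real x)) has_integral
    2 * fact k * exp (\<i> * w) * (-1) ^ k *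
      ((exp (- 2 * \<i> * w) * exp_partial k (2 * \<i> * w) - 1) / (- 2 * \<i> * w) ^ (k + 1))) {-1..1}"
proof -
  let ?a = "2 * \<i> * w"
  define F where "F z = 2 * fact k / ?a ^ (k + 1) * (exp (\<i> * w * z) * exp_partial k (?a * ((1 - z) / 2)))" for z
  have "(F has_field_derivative ((1 - z) / 2) ^ k * exp (\<i> * w * z)) (at z)" for z
  proof -
    let ?t = "?a * ((1 - z) / 2)"
    have "((\<lambda>z. exp_partial k (?a * ((1 - z) / 2))) has_field_derivative
        (exp_partial k ?t - ?t ^ k / fact k) * (- (\<i> * w))) (at z)"
      by (rule DERIV_chain2[OF has_field_derivative_exp_partial]) (auto intro!: derivative_eq_intros)
    moreover have "((\<lambda>z. exp (\<i> * w * z)) has_field_derivative exp (\<i> * w * z) * (\<i> * w)) (at z)"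
      by (auto intro!: derivative_eq_intros)
    ultimately have "(F has_field_derivative 2 * fact k / ?a ^ (k + 1) *
        (exp (\<i> * w * z) * (\<i> * w) * exp_partial k ?t
          + (exp_partial k ?t - ?t ^ k / fact k) * (- (\<i> * w)) * exp (\<i> * w * z))) (at z)"
      unfolding F_def by (intro DERIV_cmult DERIV_mult)
    also have "exp (\<i> * w * z) * (\<i> * w) * exp_partial k ?t
          + (exp_partial k ?t - ?t ^ k / fact k) * (- (\<i> * w)) * exp (\<i> * w * z)
        = ?a / 2 * (?a ^ k * ((1 - z) / 2) ^ k) / fact k * exp (\<i> * w * z)"
      unfolding power_mult_distrib[of ?a "(1 - z) / 2", symmetric] by (simp add: algebra_simps)
    also have "2 * fact k / ?a ^ (k + 1) * \<dots> = ((1 - z) / 2) ^ k * exp (\<i> * w * z)"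
      using assms by simp
    finally show ?thesis .
  qed
  then have "((\<lambda>x. F (of_real x)) has_vector_derivative
      of_real (((1 - x) / 2) ^ k) * exp (\<i> * w * of_real x)) (at x within {-1..1})" for x
    using has_vector_derivative_real_field[of F "((1 - of_real x) / 2) ^ k * exp (\<i> * w * of_real x)" x]
    by simp
  then have "((\<lambda>x. of_real (((1 - x) / 2) ^ k) * exp (\<i> * w * of_real x)) has_integral
      F (of_real 1) - F (of_real (-1))) {-1..1}"
    by (intro fundamental_theorem_of_calculus) auto
  moreover have "F (of_real 1) - F (of_real (-1)) = 2 * fact k * exp (\<i> * w) * (-1) ^ k *
      ((exp (- 2 * \<i> * w) * exp_partial k (2 * \<i> * w) - 1) / (- 2 * \<i> * w) ^ (k + 1))"
  proof -
    have "exp_partial k (0::complex) = 1"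
      by (induction k) (simp_all add: exp_partial_Suc, simp add: exp_partial_def)
    \<comment> \<open>The lower endpoint contributes exp(-iw); this rewriting extracts the common
      factor exp(iw). The sign of the odd-even power below accounts for the (-1)^k in the
      claim.\<close>
    moreover have "exp (- (\<i> * w)) = exp (\<i> * w) * exp (- ?a)"
      by (simp flip: exp_add)
    moreover have "(- ?a) ^ (k + 1) = - ((-1) ^ k * ?a ^ (k + 1))"
      by (subst power_minus) simp
    ultimately show ?thesis
      using assms by (simp add: F_def field_simps)
  qed
  ultimately show ?thesis
    by simp
qed

section \<open>The transform as a finite sum, and the collapse of the partial exponential
  sums\<close>

lemma of_real_gegenbauer_coeff:
  "of_real (gegenbauer_coeff \<nu> n k) = (gegenbauer_coeff (of_real \<nu>) n k :: 'a::{field_char_0, real_normed_field})"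
  by (simp add: gegenbauer_coeff_def pochhammer_of_real[symmetric])

lemma gegenbauer_hat_eq_sum:
  fixes w :: complex
  assumes "\<nu> > - 1 / 2" and "w \<noteq> 0"
  shows "gegenbauer_hat \<nu> n w = 2 * exp (\<i> * w) * (\<Sum>k\<le>n. gegenbauer_coeff (of_real \<nu>) n k *
    ((exp (- 2 * \<i> * w) * exp_partial k (2 * \<i> * w) - 1) / (- 2 * \<i> * w) ^ (k + 1)))"
proof -
  define c where "c k = (-1) ^ k * gegenbauer_coeff \<nu> n k / fact k" for k
  define I where "I k = 2 * fact k * exp (\<i> * w) * (-1) ^ k *
      ((exp (- 2 * \<i> * w) * exp_partial k (2 * \<i> * w) - 1) / (- 2 * \<i> * w) ^ (k + 1))" for k
  have "pochhammer (\<nu> + 1 / 2) n \<noteq> 0"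
    using assms(1) by (intro less_imp_neq[THEN not_sym] pochhammer_pos) simp
  then have "gegenbauer \<nu> n x = (\<Sum>k\<le>n. c k * ((1 - x) / 2) ^ k)" for x
    using gegenbauer_eq_sum[of \<nu> n "(1 - x) / 2"] by (simp add: c_def diff_divide_distrib)
  moreover have "((\<lambda>x. \<Sum>k\<le>n. of_real (c k) * (of_real (((1 - x) / 2) ^ k) * exp (\<i> * w * of_real x)))
      has_integral (\<Sum>k\<le>n. of_real (c k) * I k)) {-1..1}"
    unfolding I_def using assms(2)
    by (intro has_integral_sum has_integral_mult_right has_integral_power_exp) auto
  ultimately have "gegenbauer_hat \<nu> n w = (\<Sum>k\<le>n. of_real (c k) * I k)"
    unfolding gegenbauer_hat_def by (simp add: sum_distrib_right mult.assoc integral_unique)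
  \<comment> \<open>The factor (-1)^k / k! of \<open>c k\<close> cancels against (-1)^k k! in
    \<open>I k\<close>.\<close>
  also have "\<dots> = (\<Sum>k\<le>n. 2 * exp (\<i> * w) * (gegenbauer_coeff (of_real \<nu>) n k *
      ((exp (- 2 * \<i> * w) * exp_partial k (2 * \<i> * w) - 1) / (- 2 * \<i> * w) ^ (k + 1))))"
    by (intro sum.cong) (simp_all add: c_def I_def of_real_gegenbauer_coeff)
  finally show ?thesis
    by (simp only: sum_distrib_left)
qed

text \<open>Dividing E_k(z) by (-z)^(k+1) and collecting the powers z^(-(m+1)) turns k! / (k-m)!
  into a binomial coefficient times m!. After exchanging the sums, the inner sum over k is the one
  evaluated by the reflection identity. In effect E_k(z) is replaced by the sign (-1)^(n-k).\<close>

lemma sum_gegenbauer_coeff_exp_partial: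
  fixes \<nu> z :: "'a::{field_char_0, real_normed_field}"
  assumes "pochhammer (\<nu> + 1 / 2) n \<noteq> 0" and "z \<noteq> 0"
  shows "(\<Sum>k\<le>n. gegenbauer_coeff \<nu> n k * exp_partial k z / (- z) ^ (k + 1))
    = (\<Sum>k\<le>n. gegenbauer_coeff \<nu> n k * (-1) ^ (n - k) / (- z) ^ (k + 1))"
proof -
  define c where "c k = (-1) ^ k * gegenbauer_coeff \<nu> n k / fact k" for k
  have "(\<Sum>k\<le>n. gegenbauer_coeff \<nu> n k * exp_partial k z / (- z) ^ (k + 1))
      = (\<Sum>k\<in>{..n}. \<Sum>m\<in>{m\<in>{..n}. m \<le> k}. - (c k * of_nat (k choose m) * fact m / z ^ (m + 1)))"
  proof (rule sum.cong)
    fix k assume k: "k \<in> {..n}"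
    \<comment> \<open>The order is reversed so that m is tied to the power of 1/z left after the
      division: z^(k-m) / z^(k+1) = z^(-(m+1)).\<close>
    have "exp_partial k z = (\<Sum>m\<le>k. z ^ (k - m) / fact (k - m))"
      unfolding exp_partial_def atLeast0AtMost
      by (rule sum.reindex_bij_witness[of _ "\<lambda>m. k - m" "\<lambda>m. k - m"]) auto
    moreover have "gegenbauer_coeff \<nu> n k * (z ^ (k - m) / fact (k - m)) / (- z) ^ (k + 1)
        = - (c k * of_nat (k choose m) * fact m / z ^ (m + 1))" if "m \<le> k" for m
    proof -
      have "z ^ (k + 1) = z ^ (k - m) * z ^ (m + 1)"
        using that by (simp flip: power_add)
      moreover have "(- z) ^ (k + 1) = - ((-1) ^ k * z ^ (k + 1))"
        by (subst power_minus) simp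
      ultimately show ?thesis
        using that assms(2) by (simp add: c_def binomial_fact field_simps)
    qed
    moreover have "{m\<in>{..n}. m \<le> k} = {..k}"
      using k by auto
    ultimately show "gegenbauer_coeff \<nu> n k * exp_partial k z / (- z) ^ (k + 1)
        = (\<Sum>m\<in>{m\<in>{..n}. m \<le> k}. - (c k * of_nat (k choose m) * fact m / z ^ (m + 1)))"
      by (simp only: sum_distrib_left sum_divide_distrib) simp
  qed simp
  also have "\<dots> = (\<Sum>m\<in>{..n}. \<Sum>k\<in>{k\<in>{..n}. m \<le> k}. - (c k * of_nat (k choose m) * fact m / z ^ (m + 1)))"
    by (rule sum.swap_restrict) auto
  also have "\<dots> = (\<Sum>m\<le>n. - ((\<Sum>k=m..n. c k * of_nat (k choose m)) * fact m / z ^ (m + 1)))"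
    unfolding sum_distrib_right sum_divide_distrib sum_negf[symmetric]
    by (intro sum.cong) auto
  also have "\<dots> = (\<Sum>m\<le>n. gegenbauer_coeff \<nu> n m * (-1) ^ (n - m) / (- z) ^ (m + 1))"
  proof (rule sum.cong)
    fix m assume "m \<in> {..n}"
    then have m: "m \<le> n" by simp
    have "(- z) ^ (m + 1) = - ((-1) ^ m * z ^ (m + 1))"
      by (subst power_minus) simp
    moreover have "(-1::'a) ^ n = (-1) ^ (n - m) * (-1) ^ m"
      using m by (simp flip: power_add)
    ultimately show "- ((\<Sum>k=m..n. c k * of_nat (k choose m)) * fact m / z ^ (m + 1))
        = gegenbauer_coeff \<nu> n m * (-1) ^ (n - m) / (- z) ^ (m + 1)"
      using sum_gegenbauer_coeff_choose[OF assms(1) m] assms(2)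
      by (simp add: c_def field_simps)
  qed simp
  finally show ?thesis .
qed

lemma gegenbauer_hat_eq_sum':
  fixes w :: complex
  assumes "\<nu> > - 1 / 2" and "w \<noteq> 0"
  shows "gegenbauer_hat \<nu> n w = 2 * (\<Sum>k\<le>n. gegenbauer_coeff (of_real \<nu>) n k *
    (((-1) ^ (n - k) * exp (- \<i> * w) - exp (\<i> * w)) / (- 2 * \<i> * w) ^ (k + 1)))"
proof -
  let ?c = "gegenbauer_coeff (of_real \<nu> :: complex) n" and ?a = "2 * \<i> * w"
  have "pochhammer (\<nu> + 1 / 2) n \<noteq> 0"
    using assms(1) by (intro less_imp_neq[THEN not_sym] pochhammer_pos) simp
  then have "of_real (pochhammer (\<nu> + 1 / 2) n) \<noteq> (0::complex)"
    by (simp only: of_real_eq_0_iff not_False_eq_True)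
  then have "pochhammer (of_real \<nu> + 1 / 2 :: complex) n \<noteq> 0"
    by (simp flip: pochhammer_of_real)
  then have E: "(\<Sum>k\<le>n. ?c k * exp_partial k ?a / (- ?a) ^ (k + 1))
      = (\<Sum>k\<le>n. ?c k * (-1) ^ (n - k) / (- ?a) ^ (k + 1))"
    using assms(2) by (intro sum_gegenbauer_coeff_exp_partial) simp_all
  have exp: "exp (- \<i> * w) = exp (\<i> * w) * exp (- ?a)"
    by (simp flip: exp_add)
  \<comment> \<open>Separate the part containing the partial exponential sums from the part coming
    from -1; only the former changes when \<open>E\<close> is applied.\<close>
  have "gegenbauer_hat \<nu> n w = 2 * (exp (- \<i> * w) * (\<Sum>k\<le>n. ?c k * exp_partial k ?a / (- ?a) ^ (k + 1))
      - exp (\<i> * w) * (\<Sum>k\<le>n. ?c k / (- ?a) ^ (k + 1)))"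
    unfolding gegenbauer_hat_eq_sum[OF assms] exp
    by (simp only: sum_distrib_left diff_divide_distrib right_diff_distrib sum_subtractf
        times_divide_eq_right mult_ac mult_1_left mult_1_right mult_minus_left mult_minus_right)
  also have "\<dots> = 2 * (\<Sum>k\<le>n. ?c k * (((-1) ^ (n - k) * exp (- \<i> * w) - exp (\<i> * w)) / (- 2 * \<i> * w) ^ (k + 1)))"
    unfolding E
    by (simp only: sum_distrib_left diff_divide_distrib right_diff_distrib sum_subtractf
        times_divide_eq_right mult_ac mult_1_left mult_1_right mult_minus_left mult_minus_right)
  finally show ?thesis .
qed

text \<open>The duplication formula (2\<nu>)_(2k) = 4^k (\<nu>)_k (\<nu> + 1/2)_k trades (\<nu> +
  1/2)_k for the quotient in the first formula; cancelling (\<nu>)_k requires it to be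
  nonzero.\<close>

lemma gegenbauer_coeff_duplication:
  fixes \<nu> :: "'a::field_char_0"
  assumes "pochhammer \<nu> k \<noteq> 0"
  shows "gegenbauer_coeff \<nu> n k = pochhammer (2 * \<nu>) n * (2 ^ (2 * k) *
    (pochhammer (of_nat n + 2 * \<nu>) k * pochhammer \<nu> k / (fact (n - k) * pochhammer (2 * \<nu>) (2 * k))))"
  using assms by (simp add: gegenbauer_coeff_def pochhammer_double)

section \<open>The three formulas for the transform\<close>

theorem theorem4p1:
  fixes n :: nat and \<nu> :: real and w :: complex
  assumes "\<nu> > - 1 / 2" and "\<nu> \<noteq> 0" and "w \<noteq> 0"
  shows
   "gegenbauer_hat \<nu> n w =
      2 * pochhammer (2 * of_real \<nu>) n * exp (\<i> * w) *
      (\<Sum>k=0..n. 2 ^ (2 * k) *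
         (pochhammer (of_nat n + 2 * of_real \<nu>) k * pochhammer (of_real \<nu>) k
            / (fact (n - k) * pochhammer (2 * of_real \<nu>) (2 * k))) *
         ((exp (- 2 * \<i> * w) * exp_partial k (2 * \<i> * w) - 1) / (- 2 * \<i> * w) ^ (k + 1)))
    \<and>
    gegenbauer_hat \<nu> n w =
      2 * pochhammer (2 * of_real \<nu>) n * pochhammer (of_real \<nu>) n
        / pochhammer (2 * of_real \<nu>) (2 * n) *
      (\<Sum>k=0..n. 2 ^ (2 * k) *
         (pochhammer (of_nat n + 2 * of_real \<nu>) k
            * pochhammer (2 * of_real \<nu> + 2 * of_nat k) (2 * n - 2 * k)
            / (fact (n - k) * pochhammer (of_real \<nu> + of_nat k) (n - k))) *
         (((-1) ^ (n - k) * exp (- \<i> * w) - exp (\<i> * w)) / (- 2 * \<i> * w) ^ (k + 1)))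
    \<and>
    gegenbauer_hat \<nu> n w =
      pochhammer (2 * of_real \<nu>) n / (\<i> * w * fact n) *
      ((-1) ^ (n + 1) * exp (- \<i> * w) *
          hyp3F1 (of_nat n + 2 * of_real \<nu>) n 1 (of_real \<nu> + 1 / 2) (- 1 / (2 * \<i> * w))
        + exp (\<i> * w) *
          hyp3F1 (of_nat n + 2 * of_real \<nu>) n 1 (of_real \<nu> + 1 / 2) (1 / (2 * \<i> * w)))"
proof (intro conjI)
  let ?\<nu> = "of_real \<nu> :: complex" and ?a = "2 * \<i> * w"
  have nz: "?\<nu> + of_nat j \<noteq> 0" "?\<nu> + 1 / 2 + of_nat j \<noteq> 0" for j
  proof -
    \<comment> \<open>For j = 0 this is the hypothesis \<nu> \<noteq> 0; for j \<ge> 1 the sum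
      exceeds 1/2.\<close>
    have "\<nu> + of_nat j \<noteq> 0"
      using assms(1,2) by (cases j) auto
    moreover have "\<nu> + 1 / 2 + of_nat j \<noteq> 0"
      using assms(1) by (intro less_imp_neq[THEN not_sym]) (simp add: add_pos_nonneg)
    ultimately have "of_real (\<nu> + of_nat j) \<noteq> (0::complex)" "of_real (\<nu> + 1 / 2 + of_nat j) \<noteq> (0::complex)"
      by (simp_all only: of_real_eq_0_iff not_False_eq_True)
    then show "?\<nu> + of_nat j \<noteq> 0" "?\<nu> + 1 / 2 + of_nat j \<noteq> 0"
      by simp_all
  qed
  have poch_nz: "pochhammer ?\<nu> k \<noteq> 0" "pochhammer (?\<nu> + 1 / 2) k \<noteq> 0" for k
    using nz by (simp_all add: pochhammer_prod)
  have poch2_nz: "pochhammer (2 * ?\<nu>) (2 * k) \<noteq> 0" for k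
    using poch_nz by (simp add: pochhammer_double)
  show "gegenbauer_hat \<nu> n w =
      2 * pochhammer (2 * of_real \<nu>) n * exp (\<i> * w) *
      (\<Sum>k=0..n. 2 ^ (2 * k) *
         (pochhammer (of_nat n + 2 * of_real \<nu>) k * pochhammer (of_real \<nu>) k
            / (fact (n - k) * pochhammer (2 * of_real \<nu>) (2 * k))) *
         ((exp (- 2 * \<i> * w) * exp_partial k (2 * \<i> * w) - 1) / (- 2 * \<i> * w) ^ (k + 1)))"
    unfolding gegenbauer_hat_eq_sum[OF assms(1,3)] gegenbauer_coeff_duplication[OF poch_nz(1)]
      sum_distrib_left atLeast0AtMost
    by (simp only: mult_ac)
  show "gegenbauer_hat \<nu> n w =
      2 * pochhammer (2 * of_real \<nu>) n * pochhammer (of_real \<nu>) n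
        / pochhammer (2 * of_real \<nu>) (2 * n) *
      (\<Sum>k=0..n. 2 ^ (2 * k) *
         (pochhammer (of_nat n + 2 * of_real \<nu>) k
            * pochhammer (2 * of_real \<nu> + 2 * of_nat k) (2 * n - 2 * k)
            / (fact (n - k) * pochhammer (of_real \<nu> + of_nat k) (n - k))) *
         (((-1) ^ (n - k) * exp (- \<i> * w) - exp (\<i> * w)) / (- 2 * \<i> * w) ^ (k + 1)))"
    unfolding gegenbauer_hat_eq_sum'[OF assms(1,3)] sum_distrib_left atLeast0AtMost
  proof (rule sum.cong)
    fix k assume "k \<in> {..n}"
    then have k: "k \<le> n" by simp
    \<comment> \<open>Splitting both full-length shifted factorials at k writes (\<nu>)_k /
      (2\<nu>)_(2k) as the constant (\<nu>)_n / (2\<nu>)_(2n) times the quotient of the tails, which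
      is the form of the second formula.\<close>
    have s1: "pochhammer ?\<nu> n = pochhammer ?\<nu> k * pochhammer (?\<nu> + of_nat k) (n - k)"
      using k by (rule pochhammer_product)
    have s2: "pochhammer (2 * ?\<nu>) (2 * n)
        = pochhammer (2 * ?\<nu>) (2 * k) * pochhammer (2 * ?\<nu> + 2 * of_nat k) (2 * n - 2 * k)"
      using pochhammer_product[of "2 * k" "2 * n" "2 * ?\<nu>"] k by simp
    have "pochhammer (?\<nu> + of_nat k) (n - k) \<noteq> 0"
      "pochhammer (2 * ?\<nu> + 2 * of_nat k) (2 * n - 2 * k) \<noteq> 0"
      using poch_nz(1)[of n] poch2_nz[of n] unfolding s1 s2 by auto
    then have "gegenbauer_coeff ?\<nu> n k = pochhammer (2 * ?\<nu>) n * pochhammer ?\<nu> n / pochhammer (2 * ?\<nu>) (2 * n)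
        * (2 ^ (2 * k) * (pochhammer (of_nat n + 2 * ?\<nu>) k * pochhammer (2 * ?\<nu> + 2 * of_nat k) (2 * n - 2 * k)
            / (fact (n - k) * pochhammer (?\<nu> + of_nat k) (n - k))))"
      unfolding gegenbauer_coeff_duplication[OF poch_nz(1)] s1 s2 by (simp add: mult_ac)
    then show "2 * (gegenbauer_coeff ?\<nu> n k *
          (((-1) ^ (n - k) * exp (- \<i> * w) - exp (\<i> * w)) / (- 2 * \<i> * w) ^ (k + 1)))
      = 2 * pochhammer (2 * ?\<nu>) n * pochhammer ?\<nu> n / pochhammer (2 * ?\<nu>) (2 * n) *
        (2 ^ (2 * k) * (pochhammer (of_nat n + 2 * ?\<nu>) k * pochhammer (2 * ?\<nu> + 2 * of_nat k) (2 * n - 2 * k)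
            / (fact (n - k) * pochhammer (?\<nu> + of_nat k) (n - k))) *
         (((-1) ^ (n - k) * exp (- \<i> * w) - exp (\<i> * w)) / (- 2 * \<i> * w) ^ (k + 1)))"
      by (simp only: mult_ac times_divide_eq_right times_divide_eq_left divide_divide_eq_left)
  qed simp
  \<comment> \<open>Here (-n)_k = (-1)^k n! / (n-k)! and (1)_k = k!. The k! cancels, n! is absorbed
    by the prefactor, and the sign turns z^k into (-z)^k.\<close>
  have hyp: "pochhammer (2 * ?\<nu>) n / fact n * hyp3F1 (of_nat n + 2 * ?\<nu>) n 1 (?\<nu> + 1 / 2) z
      = (\<Sum>k\<le>n. gegenbauer_coeff ?\<nu> n k * (- z) ^ k)" for z
    unfolding hyp3F1_def sum_distrib_left atLeast0AtMost
  proof (rule sum.cong)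
    fix k assume "k \<in> {..n}"
    then have "pochhammer (- of_nat n) k = (-1) ^ k * fact n / (fact (n - k) :: complex)"
      using pochhammer_product[of "n - k" n "1::complex"]
      by (simp add: pochhammer_minus pochhammer_fact[symmetric] of_nat_diff algebra_simps)
    then show "pochhammer (2 * ?\<nu>) n / fact n *
        (pochhammer (of_nat n + 2 * ?\<nu>) k * pochhammer (- of_nat n) k * pochhammer 1 k
          / (pochhammer (?\<nu> + 1 / 2) k * fact k) * z ^ k)
      = gegenbauer_coeff ?\<nu> n k * (- z) ^ k"
      by (simp add: gegenbauer_coeff_def power_minus[of z] pochhammer_fact[symmetric])
  qed simp
  \<comment> \<open>With a = 2iw, 2 / (-a)^(k+1) = -(-1)^k / (iw a^k). For exp(-iw) the signs
    combine to (-1)^(n+1), which is independent of k, leaving argument -1/a; for exp(iw) the sign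
    (-1)^k remains and belongs to argument 1/a.\<close>
  have term_eq: "2 * (gegenbauer_coeff ?\<nu> n k *
        (((-1) ^ (n - k) * exp (- \<i> * w) - exp (\<i> * w)) / (- 2 * \<i> * w) ^ (k + 1)))
      = ((-1) ^ (n + 1) * exp (- \<i> * w) * (gegenbauer_coeff ?\<nu> n k * (- (- 1 / ?a)) ^ k)
        + exp (\<i> * w) * (gegenbauer_coeff ?\<nu> n k * (- (1 / ?a)) ^ k)) / (\<i> * w)" if "k \<le> n" for k
  proof -
    have "(- ?a) ^ (k + 1) = - ((-1) ^ k * (?a * ?a ^ k))"
      by (subst power_minus) simp
    moreover have "(-1::complex) ^ (n + 1) = - ((-1) ^ (n - k) * (-1) ^ k)"
      using that by (simp flip: power_add)
    moreover have "(- (1 / ?a)) ^ k = (-1) ^ k / ?a ^ k" "(- (- 1 / ?a)) ^ k = 1 / ?a ^ k"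
      by (simp_all add: power_minus[of "1 / ?a"] power_one_over)
    ultimately show ?thesis
      using assms(3) by (simp add: field_simps)
  qed
  have "gegenbauer_hat \<nu> n w =
      (\<Sum>k\<le>n. ((-1) ^ (n + 1) * exp (- \<i> * w) * (gegenbauer_coeff ?\<nu> n k * (- (- 1 / ?a)) ^ k)
        + exp (\<i> * w) * (gegenbauer_coeff ?\<nu> n k * (- (1 / ?a)) ^ k)) / (\<i> * w))"
    unfolding gegenbauer_hat_eq_sum'[OF assms(1,3)] sum_distrib_left
    by (intro sum.cong term_eq) auto
  also have "\<dots> = ((-1) ^ (n + 1) * exp (- \<i> * w) * (\<Sum>k\<le>n. gegenbauer_coeff ?\<nu> n k * (- (- 1 / ?a)) ^ k)
      + exp (\<i> * w) * (\<Sum>k\<le>n. gegenbauer_coeff ?\<nu> n k * (- (1 / ?a)) ^ k)) / (\<i> * w)"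
    by (simp only: sum_divide_distrib sum.distrib sum_distrib_left add_divide_distrib)
  finally show "gegenbauer_hat \<nu> n w =
      pochhammer (2 * of_real \<nu>) n / (\<i> * w * fact n) *
      ((-1) ^ (n + 1) * exp (- \<i> * w) *
          hyp3F1 (of_nat n + 2 * of_real \<nu>) n 1 (of_real \<nu> + 1 / 2) (- 1 / (2 * \<i> * w))
        + exp (\<i> * w) *
          hyp3F1 (of_nat n + 2 * of_real \<nu>) n 1 (of_real \<nu> + 1 / 2) (1 / (2 * \<i> * w)))"
    unfolding hyp[symmetric]
    by (simp only: add_divide_distrib distrib_left mult_ac times_divide_eq_right
        times_divide_eq_left divide_divide_eq_left)
qed

end
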